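(* In the single-channel setting of the context, suppose $p_{11}\neq p_{01}$ and the discount factor $\beta\in(0,1)$ satisfies $$\beta \le \begin{cases}\dfrac{1}{2(p_{11}-p_{01})\left[1+\sum_{i\in P}(p_{i,1}-p_{i,0})\right]}, & p_{11}>p_{01},\\[2ex] \dfrac{1}{(p_{01}-p_{11})\left[3+4\sum_{i\in P}(p_{i,1}-p_{i,0})\right]}, & p_{01}>p_{11},\end{cases}$$ where $P=\{i\in\{1,\dots,K\}:p_{i,1}-p_{i,0}\ge0\}$. Then the discount factor also satisfies $$\beta<\frac{1}{|p_{11}-p_{01}|\left[1+2\sum_{i\in P}(p_{i,1}-p_{i,0})\right]},$$ and for all $T\ge1$ and all $\omega,\omega'\in[0,1]$, $$|V_{1,T,\beta,m}(\omega)-V_{1,T,\beta,m}(\omega')|\le C|\omega-\omega'|,\qquad C=\frac{1}{1-\beta|p_{11}-p_{01}|\left[1+2\sum_{i\in P}(p_{i,1}-p_{i,0})\right]}.$$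
   Context: $p_{01},p_{11}\in[0,1]$ are transition probabilities of a two-state Markov chain on $\{0,1\}$ ($p_{01}$: from $0$ to $1$; $p_{11}$: from $1$ to $1$); $K\ge1$; $(p_{i,1})_{i=1}^K$ and $(p_{i,0})_{i=1}^K$ are probability vectors; $m\in\mathbb R$ is a fixed subsidy. For $\omega\in[0,1]$ put $\mathcal T(\omega)=p_{11}\omega+p_{01}(1-\omega)$ and $$\omega_i=\frac{p_{11}p_{i,1}\omega+p_{01}p_{i,0}(1-\omega)}{p_{i,1}\omega+p_{i,0}(1-\omega)}.$$ The $T$-horizon value function $V_{1,T,\beta,m}:[0,1]\to\mathbb R$ (maximal expected total $\beta$-discounted reward over $T$ steps, with expected reward $\omega$ when active and $m$ when passive) is given by $V_{1,0,\beta,m}\equiv0$ and, for $T\ge1$, $V_{1,T,\beta,m}(\omega)=\max\{V_{1,T,\beta,m}(\omega;a=0),V_{1,T,\beta,m}(\omega;a=1)\}$ with $$V_{1,T,\beta,m}(\omega;a=0)=m+\beta V_{1,T-1,\beta,m}(\mathcal T(\omega)),$$ $$V_{1,T,\beta,m}(\omega;a=1)=\omega+\beta\sum_{i=1}^K[p_{i,1}\omega+p_{i,0}(1-\omega)]\,V_{1,T-1,\beta,m}(\omega_i),$$ where summands with $p_{i,1}\omega+p_{i,0}(1-\omega)=0$ are read as $0$. *)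

theory Defs
  imports Complex_Main
begin

definition prob_vector :: "nat \<Rightarrow> (nat \<Rightarrow> real) \<Rightarrow> bool" where
  "prob_vector K p \<longleftrightarrow> (\<forall>i\<in>{1..K}. 0 \<le> p i) \<and> (\<Sum>i=1..K. p i) = 1"

(* The observation laws (p_{i,1})_i and (p_{i,0})_i are the functions q1 and q0, of which
   only the values at 1, ..., K matter. *)

definition obs_prob :: "(nat \<Rightarrow> real) \<Rightarrow> (nat \<Rightarrow> real) \<Rightarrow> nat \<Rightarrow> real \<Rightarrow> real" where
  "obs_prob q1 q0 i \<omega> = q1 i * \<omega> + q0 i * (1 - \<omega>)"

definition belief_passive :: "real \<Rightarrow> real \<Rightarrow> real \<Rightarrow> real" where
  "belief_passive p01 p11 \<omega> = p11 * \<omega> + p01 * (1 - \<omega>)"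

definition belief_active ::
  "real \<Rightarrow> real \<Rightarrow> (nat \<Rightarrow> real) \<Rightarrow> (nat \<Rightarrow> real) \<Rightarrow> nat \<Rightarrow> real \<Rightarrow> real" where
  "belief_active p01 p11 q1 q0 i \<omega> =
     (p11 * q1 i * \<omega> + p01 * q0 i * (1 - \<omega>)) / obs_prob q1 q0 i \<omega>"

(* One-step action values with continuation value function v. *)

definition value_passive ::
  "real \<Rightarrow> real \<Rightarrow> real \<Rightarrow> real \<Rightarrow> (real \<Rightarrow> real) \<Rightarrow> real \<Rightarrow> real" where
  "value_passive p01 p11 \<beta> m v \<omega> = m + \<beta> * v (belief_passive p01 p11 \<omega>)"

definition value_active ::
  "real \<Rightarrow> real \<Rightarrow> nat \<Rightarrow> (nat \<Rightarrow> real) \<Rightarrow> (nat \<Rightarrow> real) \<Rightarrow> real \<Rightarrow>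
   (real \<Rightarrow> real) \<Rightarrow> real \<Rightarrow> real" where
  "value_active p01 p11 K q1 q0 \<beta> v \<omega> =
     \<omega> + \<beta> * (\<Sum>i=1..K. if obs_prob q1 q0 i \<omega> = 0 then 0
                    else obs_prob q1 q0 i \<omega> * v (belief_active p01 p11 q1 q0 i \<omega>))"

(* The value function V_{1,T,\<beta>,m}. It is total on the reals but meaningful only on [0,1]:
   for \<omega> in [0,1], every belief at which the recursion evaluates the previous
   value function lies again in [0,1], so values elsewhere never enter. *)

primrec V ::
  "real \<Rightarrow> real \<Rightarrow> nat \<Rightarrow> (nat \<Rightarrow> real) \<Rightarrow> (nat \<Rightarrow> real) \<Rightarrow> real \<Rightarrow> real \<Rightarrow>
   nat \<Rightarrow> real \<Rightarrow> real" where
  "V p01 p11 K q1 q0 \<beta> m 0 = (\<lambda>\<omega>. 0)"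
| "V p01 p11 K q1 q0 \<beta> m (Suc T) =
     (\<lambda>\<omega>. max (value_passive p01 p11 \<beta> m (V p01 p11 K q1 q0 \<beta> m T) \<omega>)
               (value_active p01 p11 K q1 q0 \<beta> (V p01 p11 K q1 q0 \<beta> m T) \<omega>))"

(* The sum of p_{i,1} - p_{i,0} over P = {i : p_{i,1} - p_{i,0} \<ge> 0}. *)

definition pos_diff_sum :: "nat \<Rightarrow> (nat \<Rightarrow> real) \<Rightarrow> (nat \<Rightarrow> real) \<Rightarrow> real" where
  "pos_diff_sum K q1 q0 = (\<Sum>i\<in>{i\<in>{1..K}. q1 i - q0 i \<ge> 0}. q1 i - q0 i)"

end

theory Submission
  imports Defs "HOL-Analysis.Lipschitz"
begin

text \<open>
  The constant \<open>C\<close> is the fixed point of \<open>L \<mapsto> 1 + \<beta> \<delta> (1 + 2 S) L\<close>, where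
  \<open>\<delta> = \<bar>p11 - p01\<bar>\<close> and \<open>S\<close> is the sum of the positive differences \<open>q1 i - q0 i\<close>. The point is
  that one step of the dynamic program turns an \<open>L\<close>-Lipschitz continuation value \<open>v\<close> into a
  Lipschitz function with the constant \<open>1 + \<beta> \<delta> (1 + 2 S) L\<close>, so that \<open>C\<close> is preserved along
  the recursion, which starts at \<open>0\<close>.

  The passive action contributes only \<open>\<beta> \<delta> L\<close>, because the belief update scales distances by \<open>\<delta>\<close>. For
  the active action, moving the belief from \<open>b\<close> to \<open>a\<close> has two effects on the expected
  continuation value. Each posterior belief moves; weighted by the observation probabilities, the
  posteriors move by at most \<open>\<delta> \<bar>a - b\<bar>\<close> in total, which costs \<open>L \<delta> \<bar>a - b\<bar>\<close>. And the
  observation probabilities themselves change by \<open>(q1 i - q0 i) (a - b)\<close>. These changes sum to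
  zero, so a constant may be subtracted from \<open>v\<close>, and on the segment between \<open>p01\<close> and \<open>p11\<close>, where
  all posteriors lie, \<open>v\<close> deviates from \<open>v p01\<close> by at most \<open>L \<delta>\<close>. Since the \<open>\<bar>q1 i - q0 i\<bar>\<close> sum to
  \<open>2 S\<close>, this costs \<open>2 S L \<delta> \<bar>a - b\<bar>\<close>. The summand \<open>1\<close> is the immediate reward.

  The fixed point exists and is positive because the bound on \<open>\<beta>\<close> gives \<open>\<beta> \<delta> (1 + 2 S) < 1\<close>.
\<close>

section \<open>Differences of the observation laws\<close>

lemma pos_diff_sum_nonneg: "0 \<le> pos_diff_sum K q1 q0"
  unfolding pos_diff_sum_def by (rule sum_nonneg) simp

text \<open>Both laws have total mass one, so their positive and negative differences balance.\<close>

lemma sum_abs_diff_prob_vector: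
  assumes "prob_vector K q1" and "prob_vector K q0"
  shows "(\<Sum>i=1..K. \<bar>q1 i - q0 i\<bar>) = 2 * pos_diff_sum K q1 q0"
proof -
  have "(\<Sum>i=1..K. \<bar>q1 i - q0 i\<bar>)
      = (\<Sum>i=1..K. 2 * (if q1 i - q0 i \<ge> 0 then q1 i - q0 i else 0) - (q1 i - q0 i))"
    by (rule sum.cong) auto
  also have "\<dots> = 2 * (\<Sum>i=1..K. if q1 i - q0 i \<ge> 0 then q1 i - q0 i else 0)
      - ((\<Sum>i=1..K. q1 i) - (\<Sum>i=1..K. q0 i))"
    by (simp only: sum_subtractf sum_distrib_left)
  also have "\<dots> = 2 * pos_diff_sum K q1 q0"
    using assms unfolding pos_diff_sum_def prob_vector_def
    by (subst sum.inter_filter) auto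
  finally show ?thesis .
qed

section \<open>Posterior beliefs\<close>

lemma obs_prob_nonneg:
  assumes "0 \<le> q1 i" and "0 \<le> q0 i" and "\<omega> \<in> {0..1}"
  shows "0 \<le> obs_prob q1 q0 i \<omega>"
  using assms by (simp add: obs_prob_def)

lemma obs_prob_diff:
  "obs_prob q1 q0 i a - obs_prob q1 q0 i b = (q1 i - q0 i) * (a - b)"
  by (simp add: obs_prob_def algebra_simps)

text \<open>
  The ratio is the conditional probability of state \<open>1\<close> given observation \<open>i\<close>; the transition then
  acts on it affinely.
\<close>

lemma belief_active_eq:
  assumes "obs_prob q1 q0 i \<omega> \<noteq> 0"
  shows "belief_active p01 p11 q1 q0 i \<omega>
       = p01 + (p11 - p01) * (q1 i * \<omega> / obs_prob q1 q0 i \<omega>)"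
  using assms unfolding belief_active_def
  by (simp add: field_simps) (simp add: obs_prob_def algebra_simps)

lemma belief_active_in_segment:
  assumes "0 \<le> q1 i" and "0 \<le> q0 i" and "\<omega> \<in> {0..1}" and "obs_prob q1 q0 i \<omega> \<noteq> 0"
  shows "belief_active p01 p11 q1 q0 i \<omega> \<in> closed_segment p01 p11"
proof -
  let ?t = "q1 i * \<omega> / obs_prob q1 q0 i \<omega>"
  have "0 < obs_prob q1 q0 i \<omega>"
    using obs_prob_nonneg[of q1 i q0, OF assms(1-3)] assms(4) by simp
  moreover have "0 \<le> q1 i * \<omega>" and "q1 i * \<omega> \<le> obs_prob q1 q0 i \<omega>"
    using assms by (auto simp: obs_prob_def)
  ultimately have "0 \<le> ?t" and "?t \<le> 1"
    by (auto simp: divide_le_eq_1)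
  moreover have "belief_active p01 p11 q1 q0 i \<omega> = (1 - ?t) *\<^sub>R p01 + ?t *\<^sub>R p11"
    by (simp add: belief_active_eq[OF assms(4)] algebra_simps diff_divide_distrib)
  ultimately show ?thesis
    unfolding closed_segment_def by blast
qed

text \<open>
  The weight on the left belongs to one belief and the bound is expressed in the other. The bound is
  affine in \<open>q0 i\<close> and \<open>q1 i\<close> with coefficients summing to one, so summing it over all observations
  gives exactly \<open>\<bar>p11 - p01\<bar> * \<bar>a - b\<bar>\<close>. It rests on the inequality between the weighted harmonic
  and arithmetic means of \<open>q1 i\<close> and \<open>q0 i\<close>.
\<close>

lemma belief_active_diff_bound:
  assumes "0 \<le> q1 i" and "0 \<le> q0 i" and "a \<in> {0..1}" and "b \<in> {0..1}"
    and "obs_prob q1 q0 i a \<noteq> 0" and "obs_prob q1 q0 i b \<noteq> 0"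
  shows "obs_prob q1 q0 i b
           * \<bar>belief_active p01 p11 q1 q0 i a - belief_active p01 p11 q1 q0 i b\<bar>
       \<le> \<bar>p11 - p01\<bar> * \<bar>a - b\<bar> * (a * q0 i + (1 - a) * q1 i)"
proof -
  let ?o = "obs_prob q1 q0 i"
  have pos: "0 < ?o a" "0 < ?o b"
    using obs_prob_nonneg[of q1 i q0, OF assms(1,2)] assms(3-) by (simp_all add: less_le)
  have "belief_active p01 p11 q1 q0 i a - belief_active p01 p11 q1 q0 i b
      = (p11 - p01) * (q1 i * a / ?o a - q1 i * b / ?o b)"
    using assms(5,6) by (simp add: belief_active_eq algebra_simps)
  also have "q1 i * a / ?o a - q1 i * b / ?o b
      = (q1 i * a * ?o b - q1 i * b * ?o a) / (?o a * ?o b)"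
    using assms(5,6) by (simp add: diff_frac_eq)
  also have "q1 i * a * ?o b - q1 i * b * ?o a = q1 i * q0 i * (a - b)"
    by (simp add: obs_prob_def algebra_simps)
  finally have "?o b * \<bar>belief_active p01 p11 q1 q0 i a - belief_active p01 p11 q1 q0 i b\<bar>
      = \<bar>p11 - p01\<bar> * \<bar>a - b\<bar> * (q1 i * q0 i / ?o a)"
    using pos assms(1,2) by (simp add: abs_mult)
  also have "q1 i * q0 i / ?o a \<le> a * q0 i + (1 - a) * q1 i"
  proof -
    have "?o a * (a * q0 i + (1 - a) * q1 i) - q1 i * q0 i = a * (1 - a) * (q1 i - q0 i)\<^sup>2"
      by (simp add: obs_prob_def algebra_simps power2_eq_square)
    moreover have "0 \<le> a * (1 - a) * (q1 i - q0 i)\<^sup>2"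
      using assms(3) by simp
    ultimately show ?thesis
      using pos by (simp add: divide_le_eq mult.commute)
  qed
  finally show ?thesis
    by (simp add: mult_left_mono)
qed

section \<open>One step of the dynamic program\<close>

text \<open>
  The change of one summand of the active value, up to the movement of the posterior, is the change
  of the observation probability times a value of \<open>v\<close>. Leaving the point \<open>\<xi>\<close> free lets the statement
  cover observations that are impossible under one of the two beliefs: that belief has no posterior,
  and \<open>\<xi>\<close> is the posterior of the other belief.
\<close>

lemma active_summand_diff:
  assumes "0 \<le> q1 i" and "0 \<le> q0 i" and a: "a \<in> {0..1}" and b: "b \<in> {0..1}"
    and lip: "L-lipschitz_on (closed_segment p01 p11) v"
  defines "g \<equiv> \<lambda>\<omega>. if obs_prob q1 q0 i \<omega> = 0 then 0
                   else obs_prob q1 q0 i \<omega> * v (belief_active p01 p11 q1 q0 i \<omega>)"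
  shows "\<exists>\<xi>\<in>closed_segment p01 p11.
           \<bar>g a - g b - (q1 i - q0 i) * (a - b) * v \<xi>\<bar>
             \<le> L * (\<bar>p11 - p01\<bar> * \<bar>a - b\<bar> * (a * q0 i + (1 - a) * q1 i))"
    (is "\<exists>\<xi>\<in>_. _ \<le> ?R")
proof -
  let ?o = "obs_prob q1 q0 i" and ?w = "belief_active p01 p11 q1 q0 i"
  have L: "0 \<le> L"
    using lip by (rule lipschitz_on_nonneg)
  have R: "0 \<le> ?R"
    using L assms(1,2) a by simp
  have seg: "?w \<omega> \<in> closed_segment p01 p11" if "\<omega> \<in> {0..1}" "?o \<omega> \<noteq> 0" for \<omega>
    using belief_active_in_segment[of q1 i q0, OF assms(1,2)] that by blast
  note d = obs_prob_diff[of q1 q0 i a b]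
  consider (none) "?o a = 0" "?o b = 0" | (only_b) "?o a = 0" "?o b \<noteq> 0"
    | (only_a) "?o a \<noteq> 0" "?o b = 0" | (both) "?o a \<noteq> 0" "?o b \<noteq> 0"
    by blast
  then show ?thesis
  proof cases
    case none
    then show ?thesis
      using R by (intro bexI[of _ p01]) (simp_all add: g_def flip: d)
  next
    case only_b
    then show ?thesis
      using R seg[OF b] by (intro bexI[of _ "?w b"]) (simp_all add: g_def flip: d)
  next
    case only_a
    then show ?thesis
      using R seg[OF a] by (intro bexI[of _ "?w a"]) (simp_all add: g_def flip: d)
  next
    case both
    have "g a - g b - (q1 i - q0 i) * (a - b) * v (?w a) = ?o b * (v (?w a) - v (?w b))"
      unfolding d[symmetric] using both by (simp add: g_def algebra_simps)
    then have "\<bar>g a - g b - (q1 i - q0 i) * (a - b) * v (?w a)\<bar>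
        = ?o b * \<bar>v (?w a) - v (?w b)\<bar>"
      using obs_prob_nonneg[of q1 i q0, OF assms(1,2) b] by (simp add: abs_mult)
    also have "\<dots> \<le> ?o b * (L * \<bar>?w a - ?w b\<bar>)"
      using lipschitz_onD[OF lip seg[OF a both(1)] seg[OF b both(2)]]
        obs_prob_nonneg[of q1 i q0, OF assms(1,2) b]
      by (intro mult_left_mono) (simp_all add: dist_real_def)
    also have "\<dots> = L * (?o b * \<bar>?w a - ?w b\<bar>)"
      by simp
    also have "\<dots> \<le> ?R"
      using belief_active_diff_bound[of q1 i q0, OF assms(1,2) a b both] L by (rule mult_left_mono)
    finally show ?thesis
      using seg[OF a both(1)] by blast
  qed
qed

lemma lipschitz_on_value_active:
  assumes q1: "prob_vector K q1" and q0: "prob_vector K q0" and "0 \<le> \<beta>"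
    and lip: "L-lipschitz_on (closed_segment p01 p11) v"
  shows "(1 + \<beta> * \<bar>p11 - p01\<bar> * (1 + 2 * pos_diff_sum K q1 q0) * L)-lipschitz_on {0..1}
           (value_active p01 p11 K q1 q0 \<beta> v)"
proof (rule lipschitz_onI)
  let ?S = "pos_diff_sum K q1 q0" and ?\<delta> = "\<bar>p11 - p01\<bar>"
  have L: "0 \<le> L"
    using lip by (rule lipschitz_on_nonneg)
  show "0 \<le> 1 + \<beta> * ?\<delta> * (1 + 2 * ?S) * L"
    using L \<open>0 \<le> \<beta>\<close> pos_diff_sum_nonneg[of K q1 q0] by simp
  fix a b :: real
  assume a: "a \<in> {0..1}" and b: "b \<in> {0..1}"
  define g where "g i \<omega> = (if obs_prob q1 q0 i \<omega> = 0 then 0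
      else obs_prob q1 q0 i \<omega> * v (belief_active p01 p11 q1 q0 i \<omega>))" for i \<omega>
  define e where "e i = L * (?\<delta> * \<bar>a - b\<bar> * (a * q0 i + (1 - a) * q1 i))" for i
  have "\<forall>i\<in>{1..K}. \<exists>\<xi>\<in>closed_segment p01 p11.
      \<bar>g i a - g i b - (q1 i - q0 i) * (a - b) * v \<xi>\<bar> \<le> e i"
    using active_summand_diff[OF _ _ a b lip] q1 q0
    unfolding prob_vector_def g_def e_def by blast
  then obtain \<xi> where \<xi>: "\<And>i. i \<in> {1..K} \<Longrightarrow> \<xi> i \<in> closed_segment p01 p11"
    and ge: "\<And>i. i \<in> {1..K} \<Longrightarrow>
      \<bar>g i a - g i b - (q1 i - q0 i) * (a - b) * v (\<xi> i)\<bar> \<le> e i"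
    by metis
  have dev: "\<bar>v (\<xi> i) - v p01\<bar> \<le> L * ?\<delta>" if "i \<in> {1..K}" for i
  proof -
    have "\<bar>v (\<xi> i) - v p01\<bar> \<le> L * \<bar>\<xi> i - p01\<bar>"
      using lipschitz_onD[OF lip \<xi>[OF that] ends_in_segment(1)] by (simp add: dist_real_def)
    also have "\<dots> \<le> L * ?\<delta>"
      using segment_bound(1)[OF \<xi>[OF that]] L by (intro mult_left_mono) simp_all
    finally show ?thesis .
  qed
  have weights: "(\<Sum>i=1..K. a * q0 i + (1 - a) * q1 i) = 1"
    using q1 q0 by (simp add: prob_vector_def sum.distrib flip: sum_distrib_left)
  have balance: "(\<Sum>i=1..K. (q1 i - q0 i) * (a - b) * v p01) = 0"
    using q1 q0 by (simp add: prob_vector_def sum_subtractf flip: sum_distrib_right)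
  have "\<bar>(\<Sum>i=1..K. g i a) - (\<Sum>i=1..K. g i b)\<bar>
      = \<bar>\<Sum>i=1..K. g i a - g i b - (q1 i - q0 i) * (a - b) * v p01\<bar>"
    using balance by (simp add: sum_subtractf)
  also have "\<dots> \<le> (\<Sum>i=1..K. e i + \<bar>q1 i - q0 i\<bar> * (\<bar>a - b\<bar> * (L * ?\<delta>)))"
  proof (rule order_trans[OF sum_abs], rule sum_mono)
    fix i assume i: "i \<in> {1..K}"
    have "\<bar>g i a - g i b - (q1 i - q0 i) * (a - b) * v p01\<bar>
        \<le> \<bar>g i a - g i b - (q1 i - q0 i) * (a - b) * v (\<xi> i)\<bar>
          + \<bar>(q1 i - q0 i) * (a - b) * (v (\<xi> i) - v p01)\<bar>"
      by (simp only: right_diff_distrib)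
    also have "\<bar>(q1 i - q0 i) * (a - b) * (v (\<xi> i) - v p01)\<bar>
        = \<bar>q1 i - q0 i\<bar> * (\<bar>a - b\<bar> * \<bar>v (\<xi> i) - v p01\<bar>)"
      by (simp add: abs_mult)
    also have "\<dots> \<le> \<bar>q1 i - q0 i\<bar> * (\<bar>a - b\<bar> * (L * ?\<delta>))"
      using dev[OF i] by (intro mult_left_mono) simp_all
    finally show "\<bar>g i a - g i b - (q1 i - q0 i) * (a - b) * v p01\<bar>
        \<le> e i + \<bar>q1 i - q0 i\<bar> * (\<bar>a - b\<bar> * (L * ?\<delta>))"
      using ge[OF i] by simp
  qed
  also have "\<dots> = L * (?\<delta> * \<bar>a - b\<bar> * (\<Sum>i=1..K. a * q0 i + (1 - a) * q1 i))
      + (\<Sum>i=1..K. \<bar>q1 i - q0 i\<bar>) * (\<bar>a - b\<bar> * (L * ?\<delta>))"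
    unfolding e_def sum_distrib_left sum_distrib_right by (rule sum.distrib)
  also have "\<dots> = ?\<delta> * (1 + 2 * ?S) * L * \<bar>a - b\<bar>"
    unfolding weights sum_abs_diff_prob_vector[OF q1 q0] by (simp add: algebra_simps)
  finally have cont: "\<bar>(\<Sum>i=1..K. g i a) - (\<Sum>i=1..K. g i b)\<bar>
      \<le> ?\<delta> * (1 + 2 * ?S) * L * \<bar>a - b\<bar>" .
  have "\<bar>value_active p01 p11 K q1 q0 \<beta> v a - value_active p01 p11 K q1 q0 \<beta> v b\<bar>
      = \<bar>(a - b) + \<beta> * ((\<Sum>i=1..K. g i a) - (\<Sum>i=1..K. g i b))\<bar>"
    unfolding value_active_def g_def by (simp add: algebra_simps)
  also have "\<dots> \<le> \<bar>a - b\<bar> + \<beta> * \<bar>(\<Sum>i=1..K. g i a) - (\<Sum>i=1..K. g i b)\<bar>"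
    using \<open>0 \<le> \<beta>\<close> by (intro order_trans[OF abs_triangle_ineq]) (simp add: abs_mult)
  also have "\<dots> \<le> \<bar>a - b\<bar> + \<beta> * (?\<delta> * (1 + 2 * ?S) * L * \<bar>a - b\<bar>)"
    using mult_left_mono[OF cont \<open>0 \<le> \<beta>\<close>] by simp
  finally show "dist (value_active p01 p11 K q1 q0 \<beta> v a) (value_active p01 p11 K q1 q0 \<beta> v b)
      \<le> (1 + \<beta> * ?\<delta> * (1 + 2 * ?S) * L) * dist a b"
    by (simp add: dist_real_def algebra_simps)
qed

lemma lipschitz_on_value_passive:
  assumes "0 \<le> \<beta>" and lip: "L-lipschitz_on (closed_segment p01 p11) v"
  shows "(\<beta> * \<bar>p11 - p01\<bar> * L)-lipschitz_on {0..1} (value_passive p01 p11 \<beta> m v)"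
proof (rule lipschitz_onI)
  show "0 \<le> \<beta> * \<bar>p11 - p01\<bar> * L"
    using assms(1) lipschitz_on_nonneg[OF lip] by simp
  fix a b :: real
  assume ab: "a \<in> {0..1}" "b \<in> {0..1}"
  have seg: "belief_passive p01 p11 \<omega> \<in> closed_segment p01 p11" if "\<omega> \<in> {0..1}" for \<omega>
    using that unfolding closed_segment_def belief_passive_def
    by (auto intro!: exI[of _ \<omega>] simp: algebra_simps)
  have "belief_passive p01 p11 a - belief_passive p01 p11 b = (p11 - p01) * (a - b)"
    by (simp add: belief_passive_def algebra_simps)
  then have "\<bar>v (belief_passive p01 p11 a) - v (belief_passive p01 p11 b)\<bar>
      \<le> L * (\<bar>p11 - p01\<bar> * \<bar>a - b\<bar>)"
    using lipschitz_onD[OF lip seg seg] ab by (metis abs_mult dist_real_def)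
  from mult_left_mono[OF this assms(1)]
  show "dist (value_passive p01 p11 \<beta> m v a) (value_passive p01 p11 \<beta> m v b)
      \<le> \<beta> * \<bar>p11 - p01\<bar> * L * dist a b"
    using assms(1)
    by (simp add: value_passive_def dist_real_def abs_mult mult_ac flip: right_diff_distrib)
qed

lemma lipschitz_on_max:
  fixes f g :: "'a::metric_space \<Rightarrow> real"
  assumes "C-lipschitz_on X f" and "C-lipschitz_on X g"
  shows "C-lipschitz_on X (\<lambda>x. max (f x) (g x))"
proof (rule lipschitz_onI)
  show "0 \<le> C"
    using assms(1) by (rule lipschitz_on_nonneg)
  fix x y assume "x \<in> X" "y \<in> X"
  with lipschitz_onD[OF assms(1)] lipschitz_onD[OF assms(2)]
  have "\<bar>f x - f y\<bar> \<le> C * dist x y" and "\<bar>g x - g y\<bar> \<le> C * dist x y"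
    by (simp_all add: dist_real_def)
  then show "dist (max (f x) (g x)) (max (f y) (g y)) \<le> C * dist x y"
    unfolding dist_real_def by linarith
qed

text \<open>
  Along the recursion the constant does not grow: assumption \<open>step\<close> bounds what one step makes of
  \<open>C\<close> by \<open>C\<close> itself, hence the same constant serves every horizon.
\<close>

lemma lipschitz_on_value_function:
  assumes p: "p01 \<in> {0..1}" "p11 \<in> {0..1}"
    and q: "prob_vector K q1" "prob_vector K q0" and \<beta>: "0 \<le> \<beta>" and "0 \<le> C"
    and step: "1 + \<beta> * \<bar>p11 - p01\<bar> * (1 + 2 * pos_diff_sum K q1 q0) * C \<le> C"
  shows "C-lipschitz_on {0..1} (V p01 p11 K q1 q0 \<beta> m T)"
proof (induction T)
  case 0
  show ?case
    using \<open>0 \<le> C\<close> by (simp add: lipschitz_on_def)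
next
  case (Suc T)
  have "closed_segment p01 p11 \<subseteq> {0..1}"
    using p by (intro closed_segment_subset) auto
  with Suc have lip: "C-lipschitz_on (closed_segment p01 p11) (V p01 p11 K q1 q0 \<beta> m T)"
    by (rule lipschitz_on_subset)
  have "\<beta> * \<bar>p11 - p01\<bar> * C
      \<le> 1 + \<beta> * \<bar>p11 - p01\<bar> * (1 + 2 * pos_diff_sum K q1 q0) * C"
    using \<beta> \<open>0 \<le> C\<close> pos_diff_sum_nonneg[of K q1 q0] by (simp add: algebra_simps)
  with step have "\<beta> * \<bar>p11 - p01\<bar> * C \<le> C"
    by simp
  then show ?case
    using lipschitz_on_le[OF lipschitz_on_value_passive[OF \<beta> lip]]
      lipschitz_on_le[OF lipschitz_on_value_active[OF q \<beta> lip] step]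
    by (simp add: lipschitz_on_max)
qed

section \<open>The value function is Lipschitz uniformly in the horizon\<close>

theorem lemma3:
  fixes p01 p11 \<beta> m :: real and K :: nat and q1 q0 :: "nat \<Rightarrow> real"
  assumes "p01 \<in> {0..1}" and "p11 \<in> {0..1}"
    and "K \<ge> 1" and "prob_vector K q1" and "prob_vector K q0"
    and "p11 \<noteq> p01"
    and "0 < \<beta>" and "\<beta> < 1"
    and "\<beta> \<le> (if p11 > p01
               then 1 / (2 * (p11 - p01) * (1 + pos_diff_sum K q1 q0))
               else 1 / ((p01 - p11) * (3 + 4 * pos_diff_sum K q1 q0)))"
  shows "\<beta> < 1 / (\<bar>p11 - p01\<bar> * (1 + 2 * pos_diff_sum K q1 q0)) \<and>
    (\<forall>T\<ge>1. \<forall>\<omega>\<in>{0..1}. \<forall>\<omega>'\<in>{0..1}.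
       \<bar>V p01 p11 K q1 q0 \<beta> m T \<omega> - V p01 p11 K q1 q0 \<beta> m T \<omega>'\<bar>
         \<le> 1 / (1 - \<beta> * \<bar>p11 - p01\<bar> * (1 + 2 * pos_diff_sum K q1 q0)) * \<bar>\<omega> - \<omega>'\<bar>)"
proof -
  let ?S = "pos_diff_sum K q1 q0" and ?\<delta> = "\<bar>p11 - p01\<bar>"
  let ?c = "?\<delta> * (1 + 2 * ?S)"
  let ?C = "1 / (1 - \<beta> * ?\<delta> * (1 + 2 * ?S))"
  have S: "0 \<le> ?S"
    by (rule pos_diff_sum_nonneg)
  have \<delta>: "0 < ?\<delta>"
    using assms(6) by simp
  have c: "0 < ?c"
    using S \<delta> by simp
  \<comment> \<open>Both denominators in the hypothesis exceed the one in the claim, as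
      \<open>2 + 2 * ?S\<close> and \<open>3 + 4 * ?S\<close> exceed \<open>1 + 2 * ?S\<close>.\<close>
  have \<beta>_less: "\<beta> < 1 / ?c"
  proof (cases "p11 > p01")
    case True
    then have "\<beta> \<le> 1 / (?\<delta> * (2 + 2 * ?S))"
      using assms(9) by (simp add: algebra_simps)
    also have "\<dots> < 1 / ?c"
      using c \<delta> S by (intro divide_strict_left_mono mult_strict_left_mono mult_pos_pos) simp_all
    finally show ?thesis .
  next
    case False
    then have "\<beta> \<le> 1 / (?\<delta> * (3 + 4 * ?S))"
      using assms(9) by simp
    also have "\<dots> < 1 / ?c"
      using c \<delta> S by (intro divide_strict_left_mono mult_strict_left_mono mult_pos_pos) simp_all
    finally show ?thesis .
  qed
  then have gap: "0 < 1 - \<beta> * ?\<delta> * (1 + 2 * ?S)"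
    using c by (simp add: pos_less_divide_eq mult.assoc)
  then have "1 + \<beta> * ?\<delta> * (1 + 2 * ?S) * ?C = ?C"
    by (simp add: field_simps)
  with gap have "?C-lipschitz_on {0..1} (V p01 p11 K q1 q0 \<beta> m T)" for T
    using assms(1,2,4,5,7) by (intro lipschitz_on_value_function) simp_all
  then have "\<bar>V p01 p11 K q1 q0 \<beta> m T \<omega> - V p01 p11 K q1 q0 \<beta> m T \<omega>'\<bar> \<le> ?C * \<bar>\<omega> - \<omega>'\<bar>"
    if "\<omega> \<in> {0..1}" "\<omega>' \<in> {0..1}" for T \<omega> \<omega>'
    using that by (metis dist_real_def lipschitz_onD)
  with \<beta>_less show ?thesis
    by blast
qed

end
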